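(* Let $\Gamma$ be a finite graph, let $(X_i,p_i,\Gamma)$ be an $F_i$-graph bundle for $i=1,2$, and for each $\psi^i\in\mathrm{Aut}(F_i)$ denote by $\mathrm{perm}(\psi^i)$ the permutation matrix of $\psi^i$. Then $$A_{X_1\boxplus X_2}=\sum_{\substack{\psi^1\in\mathrm{Aut}(F_1)\\ \psi^2\in\mathrm{Aut}(F_2)}}A_\Gamma(\psi^1,\psi^2)\otimes\mathrm{perm}(\psi^1)\otimes\mathrm{perm}(\psi^2)+I_{|V_\Gamma|}\otimes A_{F_1}\otimes I_{|V_{F_2}|}+I_{|V_\Gamma|}\otimes I_{|V_{F_1}|}\otimes A_{F_2},$$ where the vertices of $X_1\boxplus X_2$ are identified with $V_\Gamma\times V_{F_1}\times V_{F_2}$ (in lexicographic order) by means of any fixed choice of isomorphisms $\sigma^i_v:p_i^{-1}(v)\to F_i$ ($v\in V_\Gamma$, $i=1,2$).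
   Context: Graphs are simple and undirected: $\Gamma=(V_\Gamma,E_\Gamma)$ with $E_\Gamma$ a set of unordered pairs of distinct vertices; $v\sim w$ means $\{v,w\}\in E_\Gamma$. A morphism of graphs $f:\Gamma_1\to\Gamma_2$ is a function $f:V_{\Gamma_1}\to V_{\Gamma_2}$ such that $v\sim w$ implies $f(v)\sim f(w)$ or $f(v)=f(w)$; it is surjective if it is surjective on vertices. An isomorphism of graphs is a bijection on vertices with $v\sim w$ iff $f(v)\sim f(w)$; $\mathrm{Aut}(F)$ is the group of isomorphisms $F\to F$. The neighborhood $N(v)$ of a vertex $v$ is the graph with vertices $v$ and all $w\sim v$, and edges $\{v,w\}$ for $w\sim v$. For a natural number $k$, a triple $(\widetilde\Gamma,p,\Gamma)$ with $p:\widetilde\Gamma\to\Gamma$ a surjective morphism of graphs is a $k$-fold covering if each $p^{-1}(v)$ has exactly $k$ vertices and, for each vertex $x$ of $\widetilde\Gamma$, $p$ restricts to an isomorphism $N(x)\to N(p(x))$. For $v\sim w$ in $\Gamma$ the covering induces a bijection $\psi_{vw}:p^{-1}(v)\to p^{-1}(w)$ sending $x$ to the unique neighbour of $x$ in $\widetilde\Gamma$ lying over $w$. Graph bundles. Let $p:X\to\Gamma$ be a surjective morphism of graphs. The fiber $p^{-1}(v)$ is the subgraph of $X$ induced on the preimage of $v$. Let $\widetilde X$ be the graph with vertex set $V_X$ whose edges are the edges $\{x,y\}$ of $X$ with $p(x)\ne p(y)$, and let $\widetilde p:\widetilde X\to\Gamma$ be the map $p$. Given a graph $F$, $(X,p,\Gamma)$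 is an $F$-graph bundle if (1) each fiber $p^{-1}(v)$ is isomorphic to $F$; (2) $\widetilde p:\widetilde X\to\Gamma$ is a $|V_F|$-fold covering; (3) for all $v\sim w$ in $\Gamma$ the bijection $\psi_{vw}:p^{-1}(v)\to p^{-1}(w)$ induced by this covering is an isomorphism of graphs. The graph $X_1\boxplus X_2$ has vertex set $\{(x,y)\in V_{X_1}\times V_{X_2}:p_1(x)=p_2(y)\}$, and $(x,y)\sim(x',y')$ iff one of: (I) $x=x'$ and $y\sim y'$; (II) $x\sim x'$, $p_1(x)=p_1(x')$ and $y=y'$; (III) $x\sim x'$, $p_1(x)\sim p_1(x')$ and $y\sim y'$. Matrix conventions. Let $\psi^i_{vw}:p_i^{-1}(v)\to p_i^{-1}(w)$ be the isomorphism induced by the bundle $(X_i,p_i,\Gamma)$ for $v\sim w$; via the chosen isomorphisms it is regarded as the automorphism $\sigma^i_w\circ\psi^i_{vw}\circ(\sigma^i_v)^{-1}\in\mathrm{Aut}(F_i)$. A vertex $(x,y)$ of $X_1\boxplus X_2$ over $v$ is identified with $(v,\sigma^1_v(x),\sigma^2_v(y))$. Orders on $V_\Gamma,V_{F_1},V_{F_2}$ are fixed. $A_\Gamma(\psi^1,\psi^2)$ is the $V_\Gamma\times V_\Gamma$ matrix whose $(v,w)$-entry is $1$ if $v\sim w$ and $\sigma^i_w\circ\psi^i_{vw}\circ(\sigma^i_v)^{-1}=\psi^i$ for both $i=1,2$, and $0$ otherwise. $\mathrm{perm}(\psi)$ has $(a,b)$-entry $1$ if $b=\psi(a)$ and $0$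 otherwise. $A_G$ denotes the $0/1$ adjacency matrix of a graph $G$, $I_n$ the identity matrix of size $n$, and $\otimes$ the Kronecker product ($A\otimes B$ has blocks $a_{ij}B$). *)

theory Defs
  imports "Jordan_Normal_Form.Matrix"
begin

section \<open>Simple graphs and their morphisms\<close>

record 'a ugraph =
  verts :: "'a set"
  edges :: "'a set set"

definition simple_graph :: "'a ugraph \<Rightarrow> bool" where
  "simple_graph G \<longleftrightarrow> (\<forall>e\<in>edges G. e \<subseteq> verts G \<and> card e = 2)"

definition adj :: "'a ugraph \<Rightarrow> 'a \<Rightarrow> 'a \<Rightarrow> bool" where
  "adj G v w \<longleftrightarrow> {v, w} \<in> edges G"

definition graph_morphism :: "'a ugraph \<Rightarrow> 'b ugraph \<Rightarrow> ('a \<Rightarrow> 'b) \<Rightarrow> bool" where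
  "graph_morphism G H f \<longleftrightarrow> f \<in> verts G \<rightarrow> verts H \<and>
     (\<forall>v w. adj G v w \<longrightarrow> adj H (f v) (f w) \<or> f v = f w)"

definition surj_graph_morphism :: "'a ugraph \<Rightarrow> 'b ugraph \<Rightarrow> ('a \<Rightarrow> 'b) \<Rightarrow> bool" where
  "surj_graph_morphism G H f \<longleftrightarrow> graph_morphism G H f \<and> f ` verts G = verts H"

definition graph_iso :: "'a ugraph \<Rightarrow> 'b ugraph \<Rightarrow> ('a \<Rightarrow> 'b) \<Rightarrow> bool" where
  "graph_iso G H f \<longleftrightarrow> bij_betw f (verts G) (verts H) \<and>
     (\<forall>v\<in>verts G. \<forall>w\<in>verts G. adj G v w \<longleftrightarrow> adj H (f v) (f w))"

text \<open>Automorphisms are taken to be extensional (\<open>undefined\<close> off the vertex set), so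
  that every automorphism is represented by exactly one HOL function and sums over
  \<open>Aut F\<close> are finite and without repetitions.\<close>

definition Aut :: "'a ugraph \<Rightarrow> ('a \<Rightarrow> 'a) set" where
  "Aut F = {f \<in> extensional (verts F). graph_iso F F f}"

definition induced_subgraph :: "'a ugraph \<Rightarrow> 'a set \<Rightarrow> 'a ugraph" where
  "induced_subgraph G S = \<lparr>verts = S, edges = {e \<in> edges G. e \<subseteq> S}\<rparr>"

text \<open>The neighborhood is a star: edges between two neighbours of \<open>v\<close> are not included.\<close>

definition nbhd :: "'a ugraph \<Rightarrow> 'a \<Rightarrow> 'a ugraph" where
  "nbhd G v = \<lparr>verts = insert v {w. adj G v w}, edges = {{v, w} | w. adj G v w}\<rparr>"

section \<open>Coverings and graph bundles\<close>

definition fiber_verts :: "'a ugraph \<Rightarrow> ('a \<Rightarrow> 'v) \<Rightarrow> 'v \<Rightarrow> 'a set" where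
  "fiber_verts X p v = {x \<in> verts X. p x = v}"

definition fiber :: "'a ugraph \<Rightarrow> ('a \<Rightarrow> 'v) \<Rightarrow> 'v \<Rightarrow> 'a ugraph" where
  "fiber X p v = induced_subgraph X (fiber_verts X p v)"

definition fold_covering :: "nat \<Rightarrow> 'a ugraph \<Rightarrow> ('a \<Rightarrow> 'v) \<Rightarrow> 'v ugraph \<Rightarrow> bool" where
  "fold_covering k X p G \<longleftrightarrow> simple_graph X \<and> simple_graph G \<and> surj_graph_morphism X G p \<and>
     (\<forall>v\<in>verts G. finite (fiber_verts X p v) \<and> card (fiber_verts X p v) = k) \<and>
     (\<forall>x\<in>verts X. graph_iso (nbhd X x) (nbhd G (p x)) p)"

text \<open>The bijection \<open>\<psi>\<^sub>v\<^sub>w\<close> between the fibers over adjacent vertices \<open>v\<close>, \<open>w\<close> induced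
  by a covering.\<close>

definition fiber_map :: "'a ugraph \<Rightarrow> ('a \<Rightarrow> 'v) \<Rightarrow> 'v \<Rightarrow> 'v \<Rightarrow> 'a \<Rightarrow> 'a" where
  "fiber_map X p v w = (\<lambda>x\<in>fiber_verts X p v. THE y. adj X x y \<and> p y = w)"

text \<open>The graph \<open>X\<close> with the edges inside the fibers removed.\<close>

definition horizontal :: "'a ugraph \<Rightarrow> ('a \<Rightarrow> 'v) \<Rightarrow> 'a ugraph" where
  "horizontal X p = \<lparr>verts = verts X, edges = {{x, y} | x y. adj X x y \<and> p x \<noteq> p y}\<rparr>"

text \<open>Finiteness of \<open>F\<close> is part of the notion, because the number of sheets of a
  \<open>|V\<^sub>F|\<close>-fold covering is a natural number; it must be said explicitly as
  \<open>card\<close> is \<open>0\<close> on infinite sets.\<close>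

definition graph_bundle :: "'f ugraph \<Rightarrow> 'a ugraph \<Rightarrow> ('a \<Rightarrow> 'v) \<Rightarrow> 'v ugraph \<Rightarrow> bool" where
  "graph_bundle F X p G \<longleftrightarrow>
     simple_graph F \<and> finite (verts F) \<and> simple_graph X \<and> simple_graph G \<and>
     surj_graph_morphism X G p \<and>
     (\<forall>v\<in>verts G. \<exists>f. graph_iso (fiber X p v) F f) \<and>
     fold_covering (card (verts F)) (horizontal X p) p G \<and>
     (\<forall>v w. adj G v w \<longrightarrow>
        graph_iso (fiber X p v) (fiber X p w) (fiber_map (horizontal X p) p v w))"

definition boxplus_verts ::
  "'a ugraph \<Rightarrow> ('a \<Rightarrow> 'v) \<Rightarrow> 'b ugraph \<Rightarrow> ('b \<Rightarrow> 'v) \<Rightarrow> ('a \<times> 'b) set" where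
  "boxplus_verts X1 p1 X2 p2 = {(x, y). x \<in> verts X1 \<and> y \<in> verts X2 \<and> p1 x = p2 y}"

definition boxplus ::
  "'v ugraph \<Rightarrow> 'a ugraph \<Rightarrow> ('a \<Rightarrow> 'v) \<Rightarrow> 'b ugraph \<Rightarrow> ('b \<Rightarrow> 'v) \<Rightarrow> ('a \<times> 'b) ugraph" where
  "boxplus G X1 p1 X2 p2 =
     \<lparr>verts = boxplus_verts X1 p1 X2 p2,
      edges = {{(x, y), (x', y')} | x y x' y'.
        (x, y) \<in> boxplus_verts X1 p1 X2 p2 \<and> (x', y') \<in> boxplus_verts X1 p1 X2 p2 \<and>
        (x = x' \<and> adj X2 y y' \<or>
         adj X1 x x' \<and> p1 x = p1 x' \<and> y = y' \<or>
         adj X1 x x' \<and> adj G (p1 x) (p1 x') \<and> adj X2 y y')}\<rparr>"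

section \<open>Trivialisations of the fibers\<close>

definition trivialisation ::
  "'f ugraph \<Rightarrow> 'a ugraph \<Rightarrow> ('a \<Rightarrow> 'v) \<Rightarrow> 'v ugraph \<Rightarrow> ('v \<Rightarrow> 'a \<Rightarrow> 'f) \<Rightarrow> bool" where
  "trivialisation F X p G \<sigma> \<longleftrightarrow> (\<forall>v\<in>verts G. graph_iso (fiber X p v) F (\<sigma> v))"

definition transition ::
  "'f ugraph \<Rightarrow> 'a ugraph \<Rightarrow> ('a \<Rightarrow> 'v) \<Rightarrow> ('v \<Rightarrow> 'a \<Rightarrow> 'f) \<Rightarrow> 'v \<Rightarrow> 'v \<Rightarrow> 'f \<Rightarrow> 'f" where
  "transition F X p \<sigma> v w =
     restrict (\<sigma> w \<circ> fiber_map (horizontal X p) p v w \<circ> inv_into (fiber_verts X p v) (\<sigma> v))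
       (verts F)"

definition boxplus_coord ::
  "('a \<Rightarrow> 'v) \<Rightarrow> ('v \<Rightarrow> 'a \<Rightarrow> 'f) \<Rightarrow> ('v \<Rightarrow> 'b \<Rightarrow> 'g) \<Rightarrow> 'a \<times> 'b \<Rightarrow> 'v \<times> 'f \<times> 'g" where
  "boxplus_coord p1 \<sigma>1 \<sigma>2 = (\<lambda>(x, y). (p1 x, \<sigma>1 (p1 x) x, \<sigma>2 (p1 x) y))"

lemma bij_betw_boxplus_coord:
  assumes t1: "trivialisation F1 X1 p1 G \<sigma>1" and t2: "trivialisation F2 X2 p2 G \<sigma>2"
    and s: "surj_graph_morphism X1 G p1"
  shows "bij_betw (boxplus_coord p1 \<sigma>1 \<sigma>2) (verts (boxplus G X1 p1 X2 p2))
           (verts G \<times> verts F1 \<times> verts F2)"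
proof -
  have b1: "bij_betw (\<sigma>1 v) (fiber_verts X1 p1 v) (verts F1)"
    and b2: "bij_betw (\<sigma>2 v) (fiber_verts X2 p2 v) (verts F2)" if "v \<in> verts G" for v
    using t1 t2 that
    by (auto simp: trivialisation_def graph_iso_def fiber_def induced_subgraph_def)
  have p: "p1 x \<in> verts G" if "x \<in> verts X1" for x
    using s that by (auto simp: surj_graph_morphism_def)
  have inj1: "x = x'" if "p1 x = p1 x'" "\<sigma>1 (p1 x') x = \<sigma>1 (p1 x') x'"
    "x \<in> verts X1" "x' \<in> verts X1" for x x'
    using inj_onD[OF bij_betw_imp_inj_on[OF b1[OF p[OF that(4)]]] that(2)] that
    by (auto simp: fiber_verts_def)
  have inj2: "y = y'" if "v \<in> verts G" "p2 y = v" "p2 y' = v" "\<sigma>2 v y = \<sigma>2 v y'"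
    "y \<in> verts X2" "y' \<in> verts X2" for v y y'
    using inj_onD[OF bij_betw_imp_inj_on[OF b2[OF that(1)]] that(4)] that
    by (auto simp: fiber_verts_def)
  have m1: "\<sigma>1 v x \<in> verts F1" if "v \<in> verts G" "x \<in> verts X1" "p1 x = v" for v x
    using bij_betwE[OF b1[OF that(1)]] that by (auto simp: fiber_verts_def)
  have m2: "\<sigma>2 v y \<in> verts F2" if "v \<in> verts G" "y \<in> verts X2" "p2 y = v" for v y
    using bij_betwE[OF b2[OF that(1)]] that by (auto simp: fiber_verts_def)
  show ?thesis
  proof (rule bij_betw_imageI)
    show "inj_on (boxplus_coord p1 \<sigma>1 \<sigma>2) (verts (boxplus G X1 p1 X2 p2))"
    proof (rule inj_onI, clarify)
      fix x y x' y'
      assume "(x, y) \<in> verts (boxplus G X1 p1 X2 p2)" "(x', y') \<in> verts (boxplus G X1 p1 X2 p2)"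
        and "boxplus_coord p1 \<sigma>1 \<sigma>2 (x, y) = boxplus_coord p1 \<sigma>1 \<sigma>2 (x', y')"
      then have x: "x \<in> verts X1" "x' \<in> verts X1" "p1 x = p1 x'" "\<sigma>1 (p1 x') x = \<sigma>1 (p1 x') x'"
        and y: "y \<in> verts X2" "y' \<in> verts X2" "p2 y = p1 x'" "p2 y' = p1 x'"
          "\<sigma>2 (p1 x') y = \<sigma>2 (p1 x') y'"
        by (auto simp: boxplus_coord_def boxplus_def boxplus_verts_def)
      show "x = x' \<and> y = y'"
        using inj1[OF x(3,4,1,2)] inj2[OF p[OF x(2)] y(3,4,5,1,2)] by blast
    qed
    show "boxplus_coord p1 \<sigma>1 \<sigma>2 ` verts (boxplus G X1 p1 X2 p2) = verts G \<times> verts F1 \<times> verts F2"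
    proof (intro equalityI subsetI)
      fix t assume "t \<in> boxplus_coord p1 \<sigma>1 \<sigma>2 ` verts (boxplus G X1 p1 X2 p2)"
      then obtain z where "t = boxplus_coord p1 \<sigma>1 \<sigma>2 z"
        and "z \<in> verts (boxplus G X1 p1 X2 p2)"
        by (rule imageE)
      moreover obtain x y where "z = (x, y)"
        by (rule prod.exhaust)
      ultimately have "t = boxplus_coord p1 \<sigma>1 \<sigma>2 (x, y)"
        and "(x, y) \<in> verts (boxplus G X1 p1 X2 p2)"
        by simp_all
      then have t: "t = (p1 x, \<sigma>1 (p1 x) x, \<sigma>2 (p1 x) y)"
        and xy: "x \<in> verts X1" "y \<in> verts X2" "p2 y = p1 x"
        by (simp_all add: boxplus_coord_def boxplus_def boxplus_verts_def)
      show "t \<in> verts G \<times> verts F1 \<times> verts F2"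
        using p[OF xy(1)] m1[OF p[OF xy(1)] xy(1) refl] m2[OF p[OF xy(1)] xy(2,3)] t by simp
    next
      fix t assume "t \<in> verts G \<times> verts F1 \<times> verts F2"
      then obtain v a b where t: "t = (v, a, b)" and v: "v \<in> verts G"
        and a: "a \<in> verts F1" and b: "b \<in> verts F2"
        by auto
      have "a \<in> \<sigma>1 v ` fiber_verts X1 p1 v" using bij_betw_imp_surj_on[OF b1[OF v]] a by simp
      then obtain x where x: "a = \<sigma>1 v x" "x \<in> fiber_verts X1 p1 v" by (rule imageE)
      have "b \<in> \<sigma>2 v ` fiber_verts X2 p2 v" using bij_betw_imp_surj_on[OF b2[OF v]] b by simp
      then obtain y where y: "b = \<sigma>2 v y" "y \<in> fiber_verts X2 p2 v" by (rule imageE)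
      show "t \<in> boxplus_coord p1 \<sigma>1 \<sigma>2 ` verts (boxplus G X1 p1 X2 p2)"
      proof (rule image_eqI)
        show "t = boxplus_coord p1 \<sigma>1 \<sigma>2 (x, y)"
          using x y t by (simp add: boxplus_coord_def fiber_verts_def)
        show "(x, y) \<in> verts (boxplus G X1 p1 X2 p2)"
          using x y by (simp add: boxplus_def boxplus_verts_def fiber_verts_def)
      qed
    qed
  qed
qed

section \<open>Matrices\<close>

text \<open>An order on a finite set of vertices is given by a list enumerating it without
  repetitions; the \<open>i\<close>-th row and column belong to the \<open>i\<close>-th list entry.\<close>

definition enumerates :: "'a list \<Rightarrow> 'a set \<Rightarrow> bool" where
  "enumerates xs S \<longleftrightarrow> distinct xs \<and> set xs = S"

definition adj_mat :: "'a list \<Rightarrow> 'a ugraph \<Rightarrow> 'r :: {zero, one} mat" where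
  "adj_mat xs G = mat (length xs) (length xs)
     (\<lambda>(i, j). if adj G (xs ! i) (xs ! j) then 1 else 0)"

definition perm_mat :: "'a list \<Rightarrow> ('a \<Rightarrow> 'a) \<Rightarrow> 'r :: {zero, one} mat" where
  "perm_mat xs f = mat (length xs) (length xs)
     (\<lambda>(i, j). if xs ! j = f (xs ! i) then 1 else 0)"

definition kronecker :: "'r :: times mat \<Rightarrow> 'r mat \<Rightarrow> 'r mat" (infixl \<open>\<otimes>\<^sub>K\<close> 70) where
  "A \<otimes>\<^sub>K B = mat (dim_row A * dim_row B) (dim_col A * dim_col B)
     (\<lambda>(i, j). A $$ (i div dim_row B, j div dim_col B) * B $$ (i mod dim_row B, j mod dim_col B))"

text \<open>\<open>A\<^sub>\<Gamma>(f1, f2)\<close> for the vertex order \<open>vs\<close>, where \<open>\<tau>1 v w\<close> and \<open>\<tau>2 v w\<close> are the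
  transition automorphisms of the two bundles.\<close>

definition transition_mat ::
  "'v list \<Rightarrow> 'v ugraph \<Rightarrow> ('v \<Rightarrow> 'v \<Rightarrow> 'f \<Rightarrow> 'f) \<Rightarrow> ('v \<Rightarrow> 'v \<Rightarrow> 'g \<Rightarrow> 'g) \<Rightarrow>
     ('f \<Rightarrow> 'f) \<Rightarrow> ('g \<Rightarrow> 'g) \<Rightarrow> 'r :: {zero, one} mat" where
  "transition_mat vs G \<tau>1 \<tau>2 f1 f2 = mat (length vs) (length vs)
     (\<lambda>(i, j). if adj G (vs ! i) (vs ! j) \<and>
                  \<tau>1 (vs ! i) (vs ! j) = f1 \<and> \<tau>2 (vs ! i) (vs ! j) = f2 then 1 else 0)"

text \<open>The vertices of \<open>X1 \<boxplus> X2\<close>, listed in the order corresponding to the lexicographic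
  order on coordinates; \<open>List.product\<close> enumerates lexicographically, and the coordinate
  map is a bijection by \<open>bij_betw_boxplus_coord\<close>.\<close>

definition boxplus_order ::
  "'v list \<Rightarrow> 'f list \<Rightarrow> 'g list \<Rightarrow> 'a ugraph \<Rightarrow> ('a \<Rightarrow> 'v) \<Rightarrow> ('v \<Rightarrow> 'a \<Rightarrow> 'f) \<Rightarrow>
     'b ugraph \<Rightarrow> ('b \<Rightarrow> 'v) \<Rightarrow> ('v \<Rightarrow> 'b \<Rightarrow> 'g) \<Rightarrow> ('a \<times> 'b) list" where
  "boxplus_order vs fs1 fs2 X1 p1 \<sigma>1 X2 p2 \<sigma>2 =
     map (inv_into (boxplus_verts X1 p1 X2 p2) (boxplus_coord p1 \<sigma>1 \<sigma>2))
       (List.product vs (List.product fs1 fs2))"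

end

theory Submission
  imports Defs
begin

text \<open>Over an edge \<open>v \<sim> w\<close> of the base, two vertices of \<open>X\<close> over \<open>v\<close> and \<open>w\<close> are adjacent iff
  the second is the image of the first under the fiber map, so in coordinates iff the transition
  automorphism sends one label to the other. Adjacency of type (III) is therefore recorded by
  exactly one pair of automorphisms, which gives the sum over \<open>Aut F1 \<times> Aut F2\<close>. Types (I) and
  (II) are adjacencies inside a fiber and give the last two terms. The three types exclude each
  other because the graphs have no loops.\<close>

section \<open>Graph bundles in coordinates\<close>

lemma adj_sym: "adj G v w \<longleftrightarrow> adj G w v"
  by (simp add: adj_def insert_commute)

lemma simple_graph_adjD:
  assumes "simple_graph G" and "adj G v w"
  shows "v \<in> verts G" and "w \<in> verts G" and "v \<noteq> w"
proof -
  have "{v, w} \<subseteq> verts G" "card {v, w} = 2"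
    using assms by (auto simp: simple_graph_def adj_def)
  then show "v \<in> verts G" "w \<in> verts G" "v \<noteq> w" by auto
qed

lemma adj_horizontal: "adj (horizontal X p) x y \<longleftrightarrow> adj X x y \<and> p x \<noteq> p y"
  using adj_sym[of X] by (auto simp: adj_def horizontal_def doubleton_eq_iff)

lemma verts_fiber [simp]: "verts (fiber X p v) = fiber_verts X p v"
  by (simp add: fiber_def induced_subgraph_def)

lemma adj_fiber:
  assumes "x \<in> fiber_verts X p v" "y \<in> fiber_verts X p v"
  shows "adj (fiber X p v) x y \<longleftrightarrow> adj X x y"
  using assms by (auto simp: adj_def fiber_def induced_subgraph_def)

lemma graph_bundleD:
  assumes "graph_bundle F X p G"
  shows "simple_graph F" "finite (verts F)" "simple_graph X" "simple_graph G"
    "surj_graph_morphism X G p" "fold_covering (card (verts F)) (horizontal X p) p G"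
    "adj G v w \<Longrightarrow> graph_iso (fiber X p v) (fiber X p w) (fiber_map (horizontal X p) p v w)"
  using assms by (auto simp: graph_bundle_def)

text \<open>The star at \<open>x\<close> maps bijectively onto the star at \<open>v\<close>, so
  \<open>w\<close> has exactly one preimage in it. That preimage is not the centre \<open>x\<close>,
  since \<open>x\<close> lies over \<open>v\<close> and a simple graph has no loop at
  \<open>v\<close>.\<close>

lemma fold_covering_unique_lift:
  assumes c: "fold_covering k X p G" and vw: "adj G v w" and x: "x \<in> fiber_verts X p v"
  shows "\<exists>!y. adj X x y \<and> p y = w"
proof -
  have xv: "x \<in> verts X" "p x = v" using x by (auto simp: fiber_verts_def)
  have ne: "v \<noteq> w" using c vw simple_graph_adjD(3) by (fastforce simp: fold_covering_def)
  have "graph_iso (nbhd X x) (nbhd G v) p" using c xv by (auto simp: fold_covering_def)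
  then have b: "bij_betw p (insert x {y. adj X x y}) (insert v {w. adj G v w})"
    by (simp add: graph_iso_def nbhd_def)
  have "w \<in> p ` insert x {y. adj X x y}" using bij_betw_imp_surj_on[OF b] vw by simp
  then obtain y where y: "adj X x y" "p y = w" using ne xv(2) by auto
  show ?thesis
  proof (rule ex1I[of _ y])
    fix y' assume "adj X x y' \<and> p y' = w"
    then show "y' = y" using bij_betw_imp_inj_on[OF b] y by (auto dest: inj_onD)
  qed (use y in simp)
qed

text \<open>Unique lifting makes the definite description in \<open>fiber_map\<close> meaningful. As
  \<open>v \<noteq> w\<close>, adjacency between points over \<open>v\<close> and \<open>w\<close>
  is the same in \<open>X\<close> and in \<open>horizontal X p\<close>.\<close>

lemma fiber_map_eq_iff:
  assumes B: "graph_bundle F X p G" and vw: "adj G v w"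
    and x: "x \<in> fiber_verts X p v" and y: "y \<in> fiber_verts X p w"
  shows "fiber_map (horizontal X p) p v w x = y \<longleftrightarrow> adj X x y"
proof -
  let ?H = "horizontal X p"
  \<comment> \<open>Removing the edges inside the fibers keeps all vertices, so both graphs have the
    same fibers and the lifting lemma applies to \<open>?H\<close>.\<close>
  have fh: "fiber_verts ?H p u = fiber_verts X p u" for u
    by (simp add: fiber_verts_def horizontal_def)
  have ne: "v \<noteq> w" using simple_graph_adjD(3)[OF graph_bundleD(4)[OF B] vw] .
  have un: "\<exists>!y. adj ?H x y \<and> p y = w"
    using fold_covering_unique_lift[OF graph_bundleD(6)[OF B] vw] x fh by blast
  have m: "fiber_map ?H p v w x = (THE y. adj ?H x y \<and> p y = w)"
    using x by (simp add: fiber_map_def fh)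
  have "fiber_map ?H p v w x = y \<longleftrightarrow> adj ?H x y \<and> p y = w"
    unfolding m using theI'[OF un] the1_equality[OF un] by metis
  also have "\<dots> \<longleftrightarrow> adj X x y"
    using x y ne by (auto simp: adj_horizontal fiber_verts_def)
  finally show ?thesis .
qed

section \<open>Isomorphisms, automorphisms and transition maps\<close>

lemma graph_iso_trans:
  assumes "graph_iso G H f" and "graph_iso H K g"
  shows "graph_iso G K (g \<circ> f)"
  using assms bij_betw_trans[of f "verts G" "verts H" g "verts K"]
  by (auto simp: graph_iso_def dest: bij_betwE)

lemma graph_iso_inv:
  assumes "graph_iso G H f"
  shows "graph_iso H G (inv_into (verts G) f)"
proof -
  have b: "bij_betw f (verts G) (verts H)"
    and a: "\<And>v w. v \<in> verts G \<Longrightarrow> w \<in> verts G \<Longrightarrow> adj G v w \<longleftrightarrow> adj H (f v) (f w)"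
    using assms by (auto simp: graph_iso_def)
  show ?thesis
    using bij_betw_inv_into[OF b] bij_betw_inv_into_right[OF b] a
    by (auto simp: graph_iso_def dest: bij_betwE)
qed

text \<open>Being an isomorphism depends only on the values at vertices; this connects the
  restricted map in \<open>transition\<close> with the extensional representatives in
  \<open>Aut\<close>.\<close>

lemma graph_iso_restrict: "graph_iso G H (restrict f (verts G)) \<longleftrightarrow> graph_iso G H f"
  by (auto simp: graph_iso_def)

text \<open>Extensionality confines \<open>Aut F\<close> to a finite function space. Finiteness
  matters because \<open>finsum\<close> over an infinite set is zero by convention.\<close>

lemma finite_Aut:
  assumes "finite (verts F)"
  shows "finite (Aut F)"
proof (rule finite_subset)
  show "Aut F \<subseteq> verts F \<rightarrow>\<^sub>E verts F"
    by (auto simp: Aut_def graph_iso_def PiE_def dest: bij_betwE)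
  show "finite (verts F \<rightarrow>\<^sub>E verts F)" using assms by (simp add: finite_PiE)
qed

text \<open>The composite runs from \<open>F\<close> through the fibers over \<open>v\<close> and
  \<open>w\<close> back to \<open>F\<close>, and each leg is an isomorphism. Hence the pair of
  transitions over an edge is one of the indices of the sum.\<close>

lemma transition_Aut:
  assumes B: "graph_bundle F X p G" and T: "trivialisation F X p G \<sigma>" and vw: "adj G v w"
  shows "transition F X p \<sigma> v w \<in> Aut F"
proof -
  have v: "v \<in> verts G" "w \<in> verts G"
    using simple_graph_adjD[OF graph_bundleD(4)[OF B] vw] by auto
  have s: "graph_iso (fiber X p v) F (\<sigma> v)" "graph_iso (fiber X p w) F (\<sigma> w)"
    using T v by (auto simp: trivialisation_def)
  have "graph_iso F F (\<sigma> w \<circ> fiber_map (horizontal X p) p v w \<circ> inv_into (fiber_verts X p v) (\<sigma> v))"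
    using graph_iso_trans[OF graph_iso_inv[OF s(1)]
        graph_iso_trans[OF graph_bundleD(7)[OF B vw] s(2)]] by simp
  then show ?thesis by (simp add: Aut_def transition_def graph_iso_restrict)
qed

text \<open>\<open>inv_into\<close> recovers \<open>x\<close> from its label, and
  \<open>\<sigma> w\<close> is injective on the fiber over \<open>w\<close>; cancelling the labels
  leaves the claim for fiber maps.\<close>

lemma transition_eq_iff:
  assumes B: "graph_bundle F X p G" and T: "trivialisation F X p G \<sigma>" and vw: "adj G v w"
    and x: "x \<in> fiber_verts X p v" and y: "y \<in> fiber_verts X p w"
  shows "transition F X p \<sigma> v w (\<sigma> v x) = \<sigma> w y \<longleftrightarrow> adj X x y"
proof -
  let ?f = "fiber_map (horizontal X p) p v w"
  have v: "v \<in> verts G" "w \<in> verts G"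
    using simple_graph_adjD[OF graph_bundleD(4)[OF B] vw] by auto
  have bv: "bij_betw (\<sigma> v) (fiber_verts X p v) (verts F)"
    and bw: "bij_betw (\<sigma> w) (fiber_verts X p w) (verts F)"
    using T v by (auto simp: trivialisation_def graph_iso_def)
  have "bij_betw ?f (fiber_verts X p v) (fiber_verts X p w)"
    using graph_bundleD(7)[OF B vw] by (simp add: graph_iso_def)
  then have fx: "?f x \<in> fiber_verts X p w" using x by (rule bij_betw_apply)
  have "transition F X p \<sigma> v w (\<sigma> v x) = \<sigma> w (?f x)"
    using bij_betw_apply[OF bv x] bij_betw_inv_into_left[OF bv x] by (simp add: transition_def)
  then have "transition F X p \<sigma> v w (\<sigma> v x) = \<sigma> w y \<longleftrightarrow> ?f x = y"
    using inj_on_eq_iff[OF bij_betw_imp_inj_on[OF bw] fx y] by simp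
  also have "\<dots> \<longleftrightarrow> adj X x y" by (rule fiber_map_eq_iff[OF B vw x y])
  finally show ?thesis .
qed

lemma trivialisation_iff:
  assumes T: "trivialisation F X p G \<sigma>" and v: "v \<in> verts G"
    and x: "x \<in> fiber_verts X p v" and y: "y \<in> fiber_verts X p v"
  shows "\<sigma> v x = \<sigma> v y \<longleftrightarrow> x = y" and "adj F (\<sigma> v x) (\<sigma> v y) \<longleftrightarrow> adj X x y"
proof -
  have s: "graph_iso (fiber X p v) F (\<sigma> v)" using T v by (auto simp: trivialisation_def)
  then show "\<sigma> v x = \<sigma> v y \<longleftrightarrow> x = y"
    using x y by (auto simp: graph_iso_def bij_betw_def inj_on_eq_iff)
  show "adj F (\<sigma> v x) (\<sigma> v y) \<longleftrightarrow> adj X x y"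
    using s x y adj_fiber[OF x y] by (simp add: graph_iso_def)
qed

section \<open>Adjacency in the product of two bundles\<close>

lemma adj_boxplus:
  "adj (boxplus G X1 p1 X2 p2) (x, y) (x', y') \<longleftrightarrow>
     (x, y) \<in> boxplus_verts X1 p1 X2 p2 \<and> (x', y') \<in> boxplus_verts X1 p1 X2 p2 \<and>
     (x = x' \<and> adj X2 y y' \<or>
      adj X1 x x' \<and> p1 x = p1 x' \<and> y = y' \<or>
      adj X1 x x' \<and> adj G (p1 x) (p1 x') \<and> adj X2 y y')" (is "_ \<longleftrightarrow> ?R x y x' y'")
proof -
  \<comment> \<open>An edge is an unordered pair, so it may be witnessed in either order; invariance
    of the three types under exchanging the endpoints reduces both orders to one.\<close>
  have sym: "?R x' y' x y \<longleftrightarrow> ?R x y x' y'"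
    using adj_sym[of X1 x x'] adj_sym[of X2 y y'] adj_sym[of G "p1 x" "p1 x'"] by auto
  have "adj (boxplus G X1 p1 X2 p2) (x, y) (x', y') \<longleftrightarrow>
      (\<exists>a b a' b'. {(x, y), (x', y')} = {(a, b), (a', b')} \<and> ?R a b a' b')"
    by (simp add: adj_def boxplus_def)
  also have "\<dots> \<longleftrightarrow> ?R x y x' y' \<or> ?R x' y' x y"
    unfolding doubleton_eq_iff prod.inject by blast
  finally show ?thesis unfolding sym by simp
qed

text \<open>Types (I) and (II) need equal base points, type (III) adjacent and hence distinct ones.
  Splitting on \<open>v = w\<close> leaves the fiber labels in one case and the transitions in the
  other.\<close>

lemma adj_boxplus_coord:
  assumes B1: "graph_bundle F1 X1 p1 G" and B2: "graph_bundle F2 X2 p2 G"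
    and T1: "trivialisation F1 X1 p1 G \<sigma>1" and T2: "trivialisation F2 X2 p2 G \<sigma>2"
    and v: "v \<in> verts G" and w: "w \<in> verts G"
    and x: "x \<in> fiber_verts X1 p1 v" and y: "y \<in> fiber_verts X2 p2 v"
    and x': "x' \<in> fiber_verts X1 p1 w" and y': "y' \<in> fiber_verts X2 p2 w"
  shows "adj (boxplus G X1 p1 X2 p2) (x, y) (x', y') \<longleftrightarrow>
     v = w \<and> \<sigma>1 v x = \<sigma>1 w x' \<and> adj F2 (\<sigma>2 v y) (\<sigma>2 w y') \<or>
     v = w \<and> adj F1 (\<sigma>1 v x) (\<sigma>1 w x') \<and> \<sigma>2 v y = \<sigma>2 w y' \<or>
     adj G v w \<and> transition F1 X1 p1 \<sigma>1 v w (\<sigma>1 v x) = \<sigma>1 w x' \<and>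
       transition F2 X2 p2 \<sigma>2 v w (\<sigma>2 v y) = \<sigma>2 w y'"
proof -
  have p: "p1 x = v" "p2 y = v" "p1 x' = w" "p2 y' = w"
    and V: "(x, y) \<in> boxplus_verts X1 p1 X2 p2" "(x', y') \<in> boxplus_verts X1 p1 X2 p2"
    using x y x' y' by (auto simp: fiber_verts_def boxplus_verts_def)
  show ?thesis
  proof (cases "v = w")
    case True
    then have "\<not> adj G v w" using simple_graph_adjD(3)[OF graph_bundleD(4)[OF B1]] by blast
    then show ?thesis
      using True V p trivialisation_iff[OF T1 w] trivialisation_iff[OF T2 w] x y x' y'
      by (simp add: adj_boxplus)
  next
    case False
    then have "x \<noteq> x'" using p by auto
    then show ?thesis
      using False V p transition_eq_iff[OF B1 T1 _ x x'] transition_eq_iff[OF B2 T2 _ y y']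
      by (auto simp: adj_boxplus)
  qed
qed

section \<open>Matrix entries\<close>

lemma finsum_mat_closed:
  assumes "\<And>k. k \<in> K \<Longrightarrow> f k \<in> carrier_mat nr nc"
  shows "finsum (module_mat TYPE('r :: comm_ring_1) nr nc) f K \<in> carrier_mat nr nc"
proof -
  interpret abelian_group "module_mat TYPE('r) nr nc" by (rule abelian_group_mat)
  show ?thesis using finsum_closed[of f K] assms by (auto simp: module_mat_simps)
qed

text \<open>Taking an entry is additive on matrices of a fixed size, so it passes through the sum by
  induction on the index set.\<close>

lemma index_finsum_mat:
  assumes "finite K" and "\<And>k. k \<in> K \<Longrightarrow> f k \<in> carrier_mat nr nc" and "i < nr" "j < nc"
  shows "finsum (module_mat TYPE('r :: comm_ring_1) nr nc) f K $$ (i, j) = (\<Sum>k\<in>K. f k $$ (i, j))"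
proof -
  interpret abelian_group "module_mat TYPE('r) nr nc" by (rule abelian_group_mat)
  show ?thesis
    using assms(1,2)
  proof (induction K rule: finite_induct)
    case empty
    then show ?case using assms(3,4) by (simp add: module_mat_simps)
  next
    case (insert k K)
    have "finsum (module_mat TYPE('r) nr nc) f (insert k K) =
        f k + finsum (module_mat TYPE('r) nr nc) f K"
      using insert.prems finsum_insert[OF insert.hyps, of f]
      unfolding module_mat_simps by blast
    \<comment> \<open>A matrix sum takes its dimensions from the right summand, so the size of the
      remaining sum is needed to read off an entry.\<close>
    moreover have "finsum (module_mat TYPE('r) nr nc) f K \<in> carrier_mat nr nc"
      using insert by (intro finsum_mat_closed) auto
    ultimately show ?case using insert assms(3,4) by (simp add: index_add_mat)
  qed
qed

section \<open>Kronecker products and lexicographic indices\<close>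

lemma kronecker_carrier:
  assumes "A \<in> carrier_mat a a'" and "B \<in> carrier_mat b b'"
  shows "A \<otimes>\<^sub>K B \<in> carrier_mat (a * b) (a' * b')"
  using assms by (intro carrier_matI) (auto simp: kronecker_def)

text \<open>The product nests to the left, so the mixed-radix digits of an index are split off from
  the last factor: first modulo \<open>c\<close>, then modulo \<open>b\<close>.\<close>

lemma index_kronecker3:
  fixes A B C :: "'r :: times mat"
  assumes A: "A \<in> carrier_mat a a" and B: "B \<in> carrier_mat b b" and C: "C \<in> carrier_mat c c"
    and i: "i < a * b * c" and j: "j < a * b * c"
  shows "(A \<otimes>\<^sub>K B \<otimes>\<^sub>K C) $$ (i, j) =
     A $$ (i div c div b, j div c div b) * B $$ (i div c mod b, j div c mod b) *
     C $$ (i mod c, j mod c)"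
proof -
  have "i div c < a * b" "j div c < a * b"
    using i j by (simp_all add: less_mult_imp_div_less)
  then show ?thesis using assms by (simp add: kronecker_def)
qed

text \<open>\<open>List.product\<close> nests to the right and first divides by the product of the
  two inner lengths. Rewriting this into the digits of \<open>index_kronecker3\<close> shows that
  lexicographic order fits the Kronecker products.\<close>

lemma nth_product3:
  assumes "i < length xs * length ys * length zs"
  shows "List.product xs (List.product ys zs) ! i =
     (xs ! (i div length zs div length ys), ys ! (i div length zs mod length ys),
      zs ! (i mod length zs))"
proof -
  have z: "0 < length ys * length zs" "0 < length zs"
    using assms by (auto intro: Nat.gr0I)
  \<comment> \<open>With the factors swapped, \<open>div_mult2_eq\<close> and
    \<open>mod_mult2_eq\<close> split off \<open>length zs\<close> first.\<close>
  have i: "i < length xs * (length zs * length ys)"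
    using assms by (simp add: ac_simps)
  have m: "i mod (length zs * length ys) < length ys * length zs"
    using z by (simp add: mult.commute)
  show ?thesis
    using product_nth[of i xs "List.product ys zs"] product_nth[OF m] i z(2)
    by (simp add: mult.commute[of "length ys"] div_mult2_eq) (simp add: mod_mult2_eq)
qed

text \<open>The coordinate map is a bijection, so applied to the \<open>i\<close>-th vertex it gives
  back the \<open>i\<close>-th triple of the product list, whose entries are found by the digits of
  \<open>i\<close>.\<close>

lemma nth_boxplus_order:
  assumes T1: "trivialisation F1 X1 p1 G \<sigma>1" and T2: "trivialisation F2 X2 p2 G \<sigma>2"
    and s: "surj_graph_morphism X1 G p1"
    and "set vs = verts G" "set fs1 = verts F1" "set fs2 = verts F2"
    and i: "i < length vs * length fs1 * length fs2"
  obtains x y where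
    "boxplus_order vs fs1 fs2 X1 p1 \<sigma>1 X2 p2 \<sigma>2 ! i = (x, y)"
    "x \<in> fiber_verts X1 p1 (vs ! (i div length fs2 div length fs1))"
    "y \<in> fiber_verts X2 p2 (vs ! (i div length fs2 div length fs1))"
    "\<sigma>1 (vs ! (i div length fs2 div length fs1)) x = fs1 ! (i div length fs2 mod length fs1)"
    "\<sigma>2 (vs ! (i div length fs2 div length fs1)) y = fs2 ! (i mod length fs2)"
proof -
  let ?l = "List.product vs (List.product fs1 fs2)" and ?V = "boxplus_verts X1 p1 X2 p2"
  let ?c = "boxplus_coord p1 \<sigma>1 \<sigma>2"
  have li: "i < length ?l" using i by (simp add: ac_simps)
  have b: "bij_betw ?c ?V (verts G \<times> verts F1 \<times> verts F2)"
    using bij_betw_boxplus_coord[OF T1 T2 s] by (simp add: boxplus_def)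
  have m: "?l ! i \<in> verts G \<times> verts F1 \<times> verts F2"
    using nth_mem[OF li] assms by auto
  obtain x y where xy: "inv_into ?V ?c (?l ! i) = (x, y)" by (rule prod.exhaust)
  have V: "(x, y) \<in> ?V" using bij_betw_apply[OF bij_betw_inv_into[OF b] m] xy by simp
  have c: "?c (x, y) = ?l ! i" using bij_betw_inv_into_right[OF b m] xy by simp
  show thesis
    by (rule that[of x y])
      (use V c li xy in \<open>auto simp: boxplus_order_def nth_product3[OF i] boxplus_coord_def
         boxplus_verts_def fiber_verts_def\<close>)
qed

text \<open>Only the index \<open>(a, b)\<close> survives. Membership is asked for under
  \<open>P\<close> alone because transition maps are known to be automorphisms only over
  edges.\<close>

lemma sum_kronecker_delta_pair:
  fixes f :: "'a \<Rightarrow> 'b \<Rightarrow> 'r :: comm_monoid_add"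
  assumes "finite A" "finite B" and "P \<Longrightarrow> a \<in> A" "P \<Longrightarrow> b \<in> B"
  shows "(\<Sum>(x, y)\<in>A \<times> B. if P \<and> a = x \<and> b = y then f x y else 0) = (if P then f a b else 0)"
proof -
  have "(\<Sum>(x, y)\<in>A \<times> B. if P \<and> a = x \<and> b = y then f x y else 0) =
      (\<Sum>z\<in>A \<times> B. if z = (a, b) then if P then f a b else 0 else 0)"
    by (rule sum.cong) (auto split: if_splits)
  also have "\<dots> = (if P then f a b else 0)"
    using assms by (auto simp: sum.delta)
  finally show ?thesis .
qed

section \<open>Comparison of the two sides entry by entry\<close>

theorem theorem4p8:
  fixes \<Gamma> :: "'v ugraph" and X1 :: "'a ugraph" and X2 :: "'b ugraph"
    and F1 :: "'f ugraph" and F2 :: "'g ugraph"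
    and p1 :: "'a \<Rightarrow> 'v" and p2 :: "'b \<Rightarrow> 'v"
    and \<sigma>1 :: "'v \<Rightarrow> 'a \<Rightarrow> 'f" and \<sigma>2 :: "'v \<Rightarrow> 'b \<Rightarrow> 'g"
    and vs :: "'v list" and fs1 :: "'f list" and fs2 :: "'g list"
  assumes "simple_graph \<Gamma>" and "finite (verts \<Gamma>)"
    and "graph_bundle F1 X1 p1 \<Gamma>" and "graph_bundle F2 X2 p2 \<Gamma>"
    and "trivialisation F1 X1 p1 \<Gamma> \<sigma>1" and "trivialisation F2 X2 p2 \<Gamma> \<sigma>2"
    and "enumerates vs (verts \<Gamma>)" and "enumerates fs1 (verts F1)" and "enumerates fs2 (verts F2)"
  shows "(adj_mat (boxplus_order vs fs1 fs2 X1 p1 \<sigma>1 X2 p2 \<sigma>2) (boxplus \<Gamma> X1 p1 X2 p2)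
            :: 'r :: comm_ring_1 mat) =
      finsum (module_mat TYPE('r) (card (verts \<Gamma>) * card (verts F1) * card (verts F2))
                                  (card (verts \<Gamma>) * card (verts F1) * card (verts F2)))
        (\<lambda>(\<psi>1, \<psi>2).
           transition_mat vs \<Gamma> (transition F1 X1 p1 \<sigma>1) (transition F2 X2 p2 \<sigma>2) \<psi>1 \<psi>2
             \<otimes>\<^sub>K perm_mat fs1 \<psi>1 \<otimes>\<^sub>K perm_mat fs2 \<psi>2)
        (Aut F1 \<times> Aut F2)
      + 1\<^sub>m (card (verts \<Gamma>)) \<otimes>\<^sub>K adj_mat fs1 F1 \<otimes>\<^sub>K 1\<^sub>m (card (verts F2))
      + 1\<^sub>m (card (verts \<Gamma>)) \<otimes>\<^sub>K 1\<^sub>m (card (verts F1)) \<otimes>\<^sub>K adj_mat fs2 F2"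
proof -
  let ?n = "length vs" and ?a = "length fs1" and ?b = "length fs2"
  let ?t1 = "transition F1 X1 p1 \<sigma>1" and ?t2 = "transition F2 X2 p2 \<sigma>2"
  let ?os = "boxplus_order vs fs1 fs2 X1 p1 \<sigma>1 X2 p2 \<sigma>2"
  let ?T = "\<lambda>(\<psi>1, \<psi>2). (transition_mat vs \<Gamma> ?t1 ?t2 \<psi>1 \<psi>2
             \<otimes>\<^sub>K perm_mat fs1 \<psi>1 \<otimes>\<^sub>K perm_mat fs2 \<psi>2 :: 'r mat)"
  note B1 = assms(3) and B2 = assms(4) and T1 = assms(5) and T2 = assms(6)
  have d: "distinct vs" "distinct fs1" "distinct fs2"
    and st: "set vs = verts \<Gamma>" "set fs1 = verts F1" "set fs2 = verts F2"
    using assms(7-9) by (auto simp: enumerates_def)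
  have card: "card (verts \<Gamma>) = ?n" "card (verts F1) = ?a" "card (verts F2) = ?b"
    using d by (auto simp: st[symmetric] distinct_card)
  have cm: "transition_mat vs \<Gamma> ?t1 ?t2 \<psi>1 \<psi>2 \<in> carrier_mat ?n ?n"
    "perm_mat fs1 \<psi>1 \<in> carrier_mat ?a ?a" "perm_mat fs2 \<psi>2 \<in> carrier_mat ?b ?b"
    "adj_mat fs1 F1 \<in> carrier_mat ?a ?a" "adj_mat fs2 F2 \<in> carrier_mat ?b ?b" for \<psi>1 \<psi>2
    by (simp_all add: transition_mat_def perm_mat_def adj_mat_def)
  have Tc: "?T \<psi> \<in> carrier_mat (?n * ?a * ?b) (?n * ?a * ?b)" for \<psi>
    by (cases \<psi>) (auto intro!: kronecker_carrier cm)
  have fin: "finite (Aut F1)" "finite (Aut F2)"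
    using finite_Aut[OF graph_bundleD(2)[OF B1]] finite_Aut[OF graph_bundleD(2)[OF B2]] .
  let ?S = "finsum (module_mat TYPE('r) (?n * ?a * ?b) (?n * ?a * ?b)) ?T (Aut F1 \<times> Aut F2)"
  let ?K1 = "1\<^sub>m ?n \<otimes>\<^sub>K adj_mat fs1 F1 \<otimes>\<^sub>K 1\<^sub>m ?b :: 'r mat"
  let ?K2 = "1\<^sub>m ?n \<otimes>\<^sub>K 1\<^sub>m ?a \<otimes>\<^sub>K adj_mat fs2 F2 :: 'r mat"
  have K1: "?K1 \<in> carrier_mat (?n * ?a * ?b) (?n * ?a * ?b)"
    and K2: "?K2 \<in> carrier_mat (?n * ?a * ?b) (?n * ?a * ?b)"
    by (auto intro!: kronecker_carrier cm)
  have S: "?S \<in> carrier_mat (?n * ?a * ?b) (?n * ?a * ?b)"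
    by (rule finsum_mat_closed) (rule Tc)
  have lo: "length ?os = ?n * ?a * ?b" by (simp add: boxplus_order_def)
  show ?thesis
    unfolding card
  proof (rule eq_matI)
    fix i j
    assume "i < dim_row (?S + ?K1 + ?K2)" and "j < dim_col (?S + ?K1 + ?K2)"
    \<comment> \<open>The last summand determines the dimensions of the whole sum, so
      \<open>K2\<close> suffices here.\<close>
    then have i: "i < ?n * ?a * ?b" and j: "j < ?n * ?a * ?b" using K2 by auto
    \<comment> \<open>The digits are positions in \<open>vs\<close>, \<open>fs1\<close> and
      \<open>fs2\<close>: base point, first label, second label.\<close>
    define i0 i1 i2 where "i0 = i div ?b div ?a" and "i1 = i div ?b mod ?a" and "i2 = i mod ?b"
    define j0 j1 j2 where "j0 = j div ?b div ?a" and "j1 = j div ?b mod ?a" and "j2 = j mod ?b"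
    have pos: "0 < ?a" "0 < ?b" using i by (auto intro: Nat.gr0I)
    have ib: "i0 < ?n" "i1 < ?a" "i2 < ?b" and jb: "j0 < ?n" "j1 < ?a" "j2 < ?b"
      using i j pos unfolding i0_def i1_def i2_def j0_def j1_def j2_def
      by (simp_all add: less_mult_imp_div_less)
    note ix = index_kronecker3[OF _ _ _ i j, folded i0_def i1_def i2_def j0_def j1_def j2_def]
    obtain x y where xy: "?os ! i = (x, y)"
      "x \<in> fiber_verts X1 p1 (vs ! i0)" "y \<in> fiber_verts X2 p2 (vs ! i0)"
      "\<sigma>1 (vs ! i0) x = fs1 ! i1" "\<sigma>2 (vs ! i0) y = fs2 ! i2"
      using nth_boxplus_order[OF T1 T2 graph_bundleD(5)[OF B1] st i]
      unfolding i0_def i1_def i2_def by blast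
    obtain x' y' where xy': "?os ! j = (x', y')"
      "x' \<in> fiber_verts X1 p1 (vs ! j0)" "y' \<in> fiber_verts X2 p2 (vs ! j0)"
      "\<sigma>1 (vs ! j0) x' = fs1 ! j1" "\<sigma>2 (vs ! j0) y' = fs2 ! j2"
      using nth_boxplus_order[OF T1 T2 graph_bundleD(5)[OF B1] st j]
      unfolding j0_def j1_def j2_def by blast
    define v w where "v = vs ! i0" and "w = vs ! j0"
    have vw: "v \<in> verts \<Gamma>" "w \<in> verts \<Gamma>" 
      using nth_mem[OF ib(1)] nth_mem[OF jb(1)] unfolding st(1) v_def w_def by simp_all
    \<comment> \<open>\<open>R1\<close> is type (II) and belongs to \<open>?K1\<close>,
      \<open>R2\<close> is type (I) and belongs to \<open>?K2\<close>, \<open>R3\<close> is type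
      (III) and belongs to \<open>?S\<close>.\<close>
    define R1 where "R1 \<longleftrightarrow> i0 = j0 \<and> adj F1 (fs1 ! i1) (fs1 ! j1) \<and> i2 = j2"
    define R2 where "R2 \<longleftrightarrow> i0 = j0 \<and> i1 = j1 \<and> adj F2 (fs2 ! i2) (fs2 ! j2)"
    define R3 where "R3 \<longleftrightarrow> adj \<Gamma> v w \<and>
      ?t1 v w (fs1 ! i1) = fs1 ! j1 \<and> ?t2 v w (fs2 ! i2) = fs2 ! j2"
    \<comment> \<open>Identity matrices compare positions while adjacency compares vertices;
      distinctness of the lists makes these the same.\<close>
    have eqs: "vs ! i0 = vs ! j0 \<longleftrightarrow> i0 = j0" "fs1 ! i1 = fs1 ! j1 \<longleftrightarrow> i1 = j1"
      "fs2 ! i2 = fs2 ! j2 \<longleftrightarrow> i2 = j2"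
      using d ib jb by (auto simp: nth_eq_iff_index_eq)
    \<comment> \<open>\<open>R1\<close> with \<open>R2\<close> would be a loop in \<open>F1\<close>,
      and either one with \<open>R3\<close> a loop in \<open>\<Gamma>\<close>. Exclusivity turns the
      indicator of the disjunction into a sum of indicators, with no \<open>1 + 1\<close> in the
      ring.\<close>
    have excl: "\<not> (R1 \<and> R2)" "\<not> (R1 \<and> R3)" "\<not> (R2 \<and> R3)"
      using simple_graph_adjD(3)[OF graph_bundleD(1)[OF B1]]
        simple_graph_adjD(3)[OF assms(1)]
      by (auto simp: R1_def R2_def R3_def v_def w_def)
    have "adj (boxplus \<Gamma> X1 p1 X2 p2) (?os ! i) (?os ! j) \<longleftrightarrow> R1 \<or> R2 \<or> R3"
      unfolding xy(1) xy'(1) adj_boxplus_coord[OF B1 B2 T1 T2 vw xy(2,3)[folded v_def]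
          xy'(2,3)[folded w_def]] xy(4,5)[folded v_def] xy'(4,5)[folded w_def]
        R1_def R2_def R3_def eqs[symmetric] v_def[symmetric] w_def[symmetric]
      by blast
    then have "(adj_mat ?os (boxplus \<Gamma> X1 p1 X2 p2) :: 'r mat) $$ (i, j) =
        (if R3 then 1 else 0) + (if R1 then 1 else 0) + (if R2 then 1 else 0)"
      using i j lo excl by (auto simp: adj_mat_def)
    moreover have "?K1 $$ (i, j) = (if R1 then 1 else 0)"
      using ib jb by (subst ix) (auto simp: adj_mat_def R1_def)
    moreover have "?K2 $$ (i, j) = (if R2 then 1 else 0)"
      using ib jb by (subst ix) (auto simp: adj_mat_def R2_def)
    moreover have "?S $$ (i, j) = (if R3 then 1 else 0)"
    proof -
      have "?S $$ (i, j) = (\<Sum>\<psi>\<in>Aut F1 \<times> Aut F2. ?T \<psi> $$ (i, j))"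
        using fin Tc i j by (intro index_finsum_mat) auto
      \<comment> \<open>The outer condition comes from the transition matrix and fixes the pair of
        automorphisms; the inner one is the product of the two permutation entries. In this shape
        the sum collapses to the pair of transitions.\<close>
      also have "\<dots> = (\<Sum>(\<psi>1, \<psi>2)\<in>Aut F1 \<times> Aut F2.
          if adj \<Gamma> v w \<and> ?t1 v w = \<psi>1 \<and> ?t2 v w = \<psi>2
          then if \<psi>1 (fs1 ! i1) = fs1 ! j1 \<and> \<psi>2 (fs2 ! i2) = fs2 ! j2 then 1 else 0 else 0)"
      proof (rule sum.cong[OF refl], clarify)
        fix \<psi>1 \<psi>2
        show "(transition_mat vs \<Gamma> ?t1 ?t2 \<psi>1 \<psi>2 \<otimes>\<^sub>K perm_mat fs1 \<psi>1 \<otimes>\<^sub>K perm_mat fs2 \<psi>2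
             :: 'r mat) $$ (i, j) =
          (if adj \<Gamma> v w \<and> ?t1 v w = \<psi>1 \<and> ?t2 v w = \<psi>2
           then if \<psi>1 (fs1 ! i1) = fs1 ! j1 \<and> \<psi>2 (fs2 ! i2) = fs2 ! j2 then 1 else 0 else 0)"
          using ib jb
          by (subst ix[OF cm(1-3)]) (auto simp: transition_mat_def perm_mat_def v_def w_def)
      qed
      also have "\<dots> = (if R3 then 1 else 0)"
        using transition_Aut[OF B1 T1] transition_Aut[OF B2 T2] fin
        by (subst sum_kronecker_delta_pair) (auto simp: R3_def)
      finally show ?thesis .
    qed
    ultimately show "(adj_mat ?os (boxplus \<Gamma> X1 p1 X2 p2) :: 'r mat) $$ (i, j) =
        (?S + ?K1 + ?K2) $$ (i, j)"
      using S K1 K2 i j by simp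
  qed (use K2 lo in \<open>auto simp: adj_mat_def\<close>)
qed

end
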